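(* Let $k\ge 3$ be an integer, and let $P_n$ denote the path on $n$ vertices. (a) For every $n\ge 2$, $cp_k(P_n) = \left\lfloor \frac{(k-3)n+1}{k-2} \right\rfloor + 1$. (b) For every $n\ge k-1$, the optimal coloring of $P_n$ (a proper coloring with no rainbow $P_k$ using exactly $cp_k(P_n)$ colors) is unique, up to renaming of colors, if and only if $n$ is $1$ more than a multiple of $k-2$.
   Context: A coloring of a finite simple undirected graph $G$ is an assignment of a color to each vertex; it is proper if adjacent vertices receive different colors. A subgraph (not necessarily induced) is rainbow if all its vertices receive pairwise different colors. $P_k$ denotes the path with $k$ vertices. $cp_k(G)$ is the maximum number of different colors used in a proper coloring of the vertices of $G$ having no rainbow subgraph isomorphic to $P_k$ (when such a coloring exists). Two colorings are regarded as the same if they differ only by renaming colors, i.e. if they induce the same partition of the vertex set into color classes. *)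

theory Defs
  imports Complex_Main "Graph_Theory.Graph_Theory"
begin

text \<open>
  Finite simple undirected graphs are the digraphs satisfying the locale
  \<^locale>\<open>graph\<close>: finite, loop-free, without parallel arcs, and symmetric, so that an edge
  \<open>uv\<close> is the pair of arcs \<open>(u,v)\<close>, \<open>(v,u)\<close>.
\<close>

definition path_graph :: "nat \<Rightarrow> nat pair_pre_digraph" where
  "path_graph n = \<lparr> pverts = {..<n},
     parcs = {(i, j). i < n \<and> j < n \<and> (j = Suc i \<or> i = Suc j)} \<rparr>"

lemma pair_graph_path_graph: "pair_graph (path_graph n)"
proof -
  have "finite (parcs (path_graph n))"
    by (rule finite_subset[of _ "{..<n} \<times> {..<n}"]) (auto simp: path_graph_def)
  then show ?thesis
    by unfold_locales (auto simp: path_graph_def symmetric_def intro!: symI)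
qed

text \<open>
  A coloring is a function from vertices to \<^typ>\<open>nat\<close>; only its values on the vertex set matter.
\<close>

definition proper_coloring :: "('a, 'b) pre_digraph \<Rightarrow> ('a \<Rightarrow> nat) \<Rightarrow> bool" where
  "proper_coloring G c \<longleftrightarrow> (\<forall>u v. u \<rightarrow>\<^bsub>G\<^esub> v \<longrightarrow> c u \<noteq> c v)"

definition rainbow :: "('a, 'b) pre_digraph \<Rightarrow> ('a \<Rightarrow> nat) \<Rightarrow> bool" where
  "rainbow H c \<longleftrightarrow> inj_on c (verts H)"

text \<open>
  A subdigraph isomorphic to the symmetric digraph of a path is itself symmetric, so the subgraphs
  \<open>H\<close> below are exactly the (not necessarily induced) undirected subgraphs isomorphic to \<open>P\<^sub>k\<close>.
\<close>

definition has_rainbow_path :: "nat \<Rightarrow> ('a, 'b) pre_digraph \<Rightarrow> ('a \<Rightarrow> nat) \<Rightarrow> bool" where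
  "has_rainbow_path k G c \<longleftrightarrow>
     (\<exists>H. subgraph H G \<and> digraph_iso H (with_proj (path_graph k)) \<and> rainbow H c)"

definition valid_coloring :: "nat \<Rightarrow> ('a, 'b) pre_digraph \<Rightarrow> ('a \<Rightarrow> nat) \<Rightarrow> bool" where
  "valid_coloring k G c \<longleftrightarrow> proper_coloring G c \<and> \<not> has_rainbow_path k G c"

definition num_colors :: "('a, 'b) pre_digraph \<Rightarrow> ('a \<Rightarrow> nat) \<Rightarrow> nat" where
  "num_colors G c = card (c ` verts G)"

text \<open>
  The maximum is meaningful only if \<open>G\<close> has a valid coloring; on the empty set \<^const>\<open>Max\<close> is
  unspecified.
\<close>

definition cp :: "nat \<Rightarrow> ('a, 'b) pre_digraph \<Rightarrow> nat" where
  "cp k G = Max {num_colors G c | c. valid_coloring k G c}"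

lemma (in fin_digraph) finite_num_colors: "finite {num_colors G c | c. valid_coloring k G c}"
  by (rule finite_subset[of _ "{..card (verts G)}"]) (auto simp: num_colors_def intro: card_image_le)

definition optimal_coloring :: "nat \<Rightarrow> ('a, 'b) pre_digraph \<Rightarrow> ('a \<Rightarrow> nat) \<Rightarrow> bool" where
  "optimal_coloring k G c \<longleftrightarrow> valid_coloring k G c \<and> num_colors G c = cp k G"

definition color_classes :: "('a, 'b) pre_digraph \<Rightarrow> ('a \<Rightarrow> nat) \<Rightarrow> 'a set set" where
  "color_classes G c = {{v \<in> verts G. c v = x} | x. x \<in> c ` verts G}"

definition unique_optimal_coloring :: "nat \<Rightarrow> ('a, 'b) pre_digraph \<Rightarrow> bool" where
  "unique_optimal_coloring k G \<longleftrightarrow>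
     (\<exists>c. optimal_coloring k G c \<and>
       (\<forall>c'. optimal_coloring k G c' \<longrightarrow> color_classes G c' = color_classes G c))"

end

theory Submission
  imports Defs
begin

text \<open>
  Write \<open>d = k - 2\<close> and call a vertex \<open>j\<close> a repeat if its color occurs at some \<open>i < j\<close>; the number
  of colors is \<open>n\<close> minus the number of repeats. A valid coloring is one in which adjacent vertices
  differ and each window of \<open>k\<close> consecutive vertices contains two vertices of equal color, which are
  then at distance at least 2. The windows starting at \<open>t * d\<close> overlap in only two vertices, so they
  contain different repeats, which gives at least \<open>r = (n - 2) div d\<close> repeats. Giving \<open>t * d + 1\<close> the color
  of \<open>t * d - 1\<close> for \<open>1 \<le> t \<le> r\<close>, and a new color to every other vertex, attains this bound.

  If \<open>n = m * d + 1\<close>, then in an optimal coloring going through the windows starting at \<open>t * d - 1\<close> from right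
  to left forces the repeats to be these ones. Otherwise the last repeat may be moved one step to the
  left.
\<close>

section \<open>Colorings of paths\<close>

text \<open>The visited set is always an interval with the current position at one end, and a unit
  step to a new vertex can only extend it there. The endpoint clause is what carries the
  induction.\<close>

lemma injective_walk_interval:
  fixes h :: "nat \<Rightarrow> nat"
  assumes "inj_on h {..k}"
    and "\<And>i. i < k \<Longrightarrow> h (Suc i) = Suc (h i) \<or> h i = Suc (h (Suc i))"
  shows "\<exists>s. h ` {..k} = {s..s + k} \<and> (h k = s \<or> h k = s + k)"
  using assms
proof (induction k)
  case 0
  then show ?case by auto
next
  case (Suc k)
  have "inj_on h {..k}"
    using Suc.prems(1) by (rule inj_on_subset) auto
  then obtain s where s: "h ` {..k} = {s..s + k}" "h k = s \<or> h k = s + k"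
    using Suc.IH Suc.prems(2) by (metis less_SucI)
  have img: "h ` {..Suc k} = insert (h (Suc k)) {s..s + k}"
    by (simp add: atMost_Suc s(1))
  have "h (Suc k) \<notin> h ` {..k}"
    using Suc.prems(1) by (simp add: atMost_Suc)
  then have new: "h (Suc k) < s \<or> s + k < h (Suc k)"
    unfolding s(1) by auto
  have "Suc (h (Suc k)) = s \<or> h (Suc k) = Suc (s + k)"
    using new s(2) Suc.prems(2)[of k] by auto
  then show ?case
  proof
    assume *: "Suc (h (Suc k)) = s"
    have "insert (h (Suc k)) {s..s + k} = {h (Suc k)..h (Suc k) + Suc k}"
      using * by auto
    then show ?thesis using img by blast
  next
    assume *: "h (Suc k) = Suc (s + k)"
    then have "insert (h (Suc k)) {s..s + k} = {s..s + Suc k}"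
      by auto
    then show ?thesis using img * by (intro exI[of _ s]) simp
  qed
qed

text \<open>Read backwards, the isomorphism is an injective walk with unit steps, so the vertices of
  \<open>H\<close> are \<open>k\<close> consecutive numbers.\<close>

lemma rainbow_path_interval:
  assumes "has_rainbow_path k (with_proj (path_graph n)) c" "0 < k"
  shows "\<exists>s. s + k \<le> n \<and> inj_on c {s..<s + k}"
proof -
  obtain H f where H: "subgraph H (with_proj (path_graph n))" "rainbow H c"
    and f: "pre_digraph.digraph_isomorphism H f" "with_proj (path_graph k) = app_iso f H"
    using assms(1) unfolding has_rainbow_path_def digraph_iso_def by blast
  have th: "tail H = fst" "head H = snd"
    using H(1) by (auto simp: subgraph_def compatible_def)
  have wf: "wf_digraph H"
    using H(1) by (auto simp: subgraph_def)
  have inj: "inj_on (iso_verts f) (verts H)"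
    using f(1) by (simp add: pre_digraph.digraph_isomorphism_def)
  have img: "iso_verts f ` verts H = {..<k}"
    using arg_cong[OF f(2), of verts] by (simp add: path_graph_def)
  \<comment> \<open>\<open>app_iso\<close> takes its tail and head functions from \<open>f\<close>,
    so equality with the path graph forces both to be projections.\<close>
  have tails: "iso_tail f = fst" "iso_head f = snd"
    using arg_cong[OF f(2), of tail] arg_cong[OF f(2), of head] by simp_all
  define h where "h = the_inv_into (verts H) (iso_verts f)"
  have bij: "bij_betw h {..<k} (verts H)"
    unfolding h_def using inj img by (intro bij_betw_the_inv_into) (simp add: bij_betw_def)
  have step: "h (Suc i) = Suc (h i) \<or> h i = Suc (h (Suc i))" if "Suc i < k" for i
  proof -
    have "(i, Suc i) \<in> arcs (with_proj (path_graph k))"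
      using that by (simp add: path_graph_def)
    then obtain a where a: "a \<in> arcs H" "iso_arcs f a = (i, Suc i)"
      unfolding f(2) by auto
    have "iso_verts f (fst a) = i" "iso_verts f (snd a) = Suc i"
      using f(1) a by (auto simp: pre_digraph.digraph_isomorphism_def th tails)
    moreover have "fst a \<in> verts H" "snd a \<in> verts H"
      using wf_digraph.tail_in_verts[OF wf a(1)] wf_digraph.head_in_verts[OF wf a(1)] th by auto
    ultimately have "fst a = h i" "snd a = h (Suc i)"
      unfolding h_def using inj by (metis the_inv_into_f_f)+
    moreover have "a \<in> parcs (path_graph n)"
      using H(1) a(1) by (auto simp: subgraph_def)
    ultimately show ?thesis
      by (auto simp: path_graph_def)
  qed
  obtain k' where k': "k = Suc k'"
    using assms(2) by (cases k) auto
  have "\<exists>s. h ` {..k'} = {s..s + k'} \<and> (h k' = s \<or> h k' = s + k')"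
    by (rule injective_walk_interval) (use bij step k' in \<open>auto simp: bij_betw_def lessThan_Suc_atMost\<close>)
  then obtain s where "h ` {..k'} = {s..s + k'}" by blast
  then have "verts H = {s..<s + k}"
    using bij k' by (simp add: bij_betw_def lessThan_Suc_atMost atLeastLessThanSuc_atLeastAtMost)
  moreover have "verts H \<subseteq> {..<n}"
    using H(1) by (auto simp: subgraph_def path_graph_def)
  ultimately have "{s..<s + k} \<subseteq> {..<n}" "inj_on c {s..<s + k}"
    using H(2) by (auto simp: rainbow_def)
  then show ?thesis
    using assms(2) by (intro exI[of _ s]) (auto simp: subset_eq dest!: bspec[of _ _ "s + k - 1"])
qed

text \<open>The copy of the path is the subgraph induced on the window, and translation by
  \<open>s\<close> is the isomorphism.\<close>

lemma interval_rainbow_path: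
  assumes "s + k \<le> n" "inj_on c {s..<s + k}"
  shows "has_rainbow_path k (with_proj (path_graph n)) c"
proof -
  define A where "A = {(i, j). i \<in> {s..<s + k} \<and> j \<in> {s..<s + k} \<and> (j = Suc i \<or> i = Suc j)}"
  define H where "H = with_proj \<lparr>pverts = {s..<s + k}, parcs = A\<rparr>"
  have wf: "wf_digraph H"
    by unfold_locales (auto simp: H_def A_def)
  have "wf_digraph (with_proj (path_graph n))"
    by unfold_locales (auto simp: path_graph_def)
  then have sub: "subgraph H (with_proj (path_graph n))"
    using assms(1) wf
    by (auto simp: subgraph_def H_def A_def path_graph_def compatible_def)
  define f :: "(nat, nat \<times> nat, nat, nat \<times> nat) digraph_isomorphism" where
    "f = \<lparr>iso_verts = (\<lambda>v. v - s), iso_arcs = map_prod (\<lambda>v. v - s) (\<lambda>v. v - s),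
          iso_head = snd, iso_tail = fst\<rparr>"
  have "pre_digraph.digraph_isomorphism H f"
    using wf by (auto simp: pre_digraph.digraph_isomorphism_def f_def H_def A_def inj_on_def)
  moreover have "(\<lambda>v. v - s) ` {s..<s + k} = {..<k}"
    by (auto simp: image_iff intro!: bexI[of _ "_ + s"])
  moreover have "map_prod (\<lambda>v. v - s) (\<lambda>v. v - s) ` A = parcs (path_graph k)"
  proof (intro equalityI subsetI)
    fix p assume "p \<in> parcs (path_graph k)"
    then have "(fst p + s, snd p + s) \<in> A"
      by (auto simp: A_def path_graph_def)
    then show "p \<in> map_prod (\<lambda>v. v - s) (\<lambda>v. v - s) ` A"
      by (rule rev_image_eqI) simp
  qed (auto simp: A_def path_graph_def)
  ultimately have "digraph_iso H (with_proj (path_graph k))"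
    unfolding digraph_iso_def
    by (intro exI[of _ f]) (auto simp: app_iso_def with_proj_def f_def H_def path_graph_def)
  moreover have "rainbow H c"
    using assms(2) by (simp add: rainbow_def H_def)
  ultimately show ?thesis
    using sub unfolding has_rainbow_path_def by blast
qed

text \<open>All later arguments use validity only in this form, free of subgraphs and
  isomorphisms.\<close>

lemma valid_coloring_path_graph_iff:
  assumes "0 < k"
  shows "valid_coloring k (with_proj (path_graph n)) c \<longleftrightarrow>
    (\<forall>i. Suc i < n \<longrightarrow> c i \<noteq> c (Suc i)) \<and> (\<forall>s. s + k \<le> n \<longrightarrow> \<not> inj_on c {s..<s + k})"
proof -
  have "proper_coloring (with_proj (path_graph n)) c \<longleftrightarrow> (\<forall>i. Suc i < n \<longrightarrow> c i \<noteq> c (Suc i))"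
    by (auto simp: proper_coloring_def path_graph_def)
  then show ?thesis
    using rainbow_path_interval[OF _ assms, of n c] interval_rainbow_path[of _ k n c]
    unfolding valid_coloring_def by blast
qed

text \<open>Each class is determined by any of its members, so equality of partitions reduces to a
  condition on pairs of vertices.\<close>

lemma color_classes_eq_iff:
  "color_classes G c = color_classes G c' \<longleftrightarrow>
    (\<forall>u\<in>verts G. \<forall>v\<in>verts G. c u = c v \<longleftrightarrow> c' u = c' v)"
proof -
  have eq: "color_classes G b = (\<lambda>u. {v \<in> verts G. b v = b u}) ` verts G" for b
    by (auto simp: color_classes_def)
  show ?thesis
  proof
    assume *: "color_classes G c = color_classes G c'"
    have "{v \<in> verts G. c v = c u} = {v \<in> verts G. c' v = c' u}" if u: "u \<in> verts G" for u
    proof -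
      have "{v \<in> verts G. c v = c u} \<in> color_classes G c'"
        using u unfolding *[symmetric] unfolding eq[of c] by blast
      then obtain w where w: "{v \<in> verts G. c v = c u} = {v \<in> verts G. c' v = c' w}"
        unfolding eq by blast
      then have "c' u = c' w" using u by blast
      with w show ?thesis by simp
    qed
    then show "\<forall>u\<in>verts G. \<forall>v\<in>verts G. c u = c v \<longleftrightarrow> c' u = c' v"
      by blast
  next
    assume "\<forall>u\<in>verts G. \<forall>v\<in>verts G. c u = c v \<longleftrightarrow> c' u = c' v"
    then show "color_classes G c = color_classes G c'"
      unfolding eq by (intro image_cong) auto
  qed
qed

section \<open>Repeats\<close>

definition repeats :: "(nat \<Rightarrow> 'a) \<Rightarrow> nat \<Rightarrow> nat set" where
  "repeats c n = {j. j < n \<and> (\<exists>i<j. c i = c j)}"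

lemma finite_repeats [simp]: "finite (repeats c n)"
  by (simp add: repeats_def)

lemma inj_on_diff_repeats: "inj_on c ({..<n} - repeats c n)"
  by (rule linorder_inj_onI) (auto simp: repeats_def)

text \<open>Non-repeats are first occurrences of colors. Passing to earlier vertices of the same
  color ends in one of them, so they represent each color exactly once.\<close>

lemma card_image_add_repeats: "card (c ` {..<n}) + card (repeats c n) = n"
proof -
  have "c j \<in> c ` ({..<n} - repeats c n)" if "j < n" for j
    using that
  proof (induction j rule: less_induct)
    case (less j)
    show ?case
    proof (cases "j \<in> repeats c n")
      case True
      then obtain i where "i < j" "c i = c j" by (auto simp: repeats_def)
      then show ?thesis using less.IH[of i] less.prems by simp
    next
      case False
      then show ?thesis using less.prems by blast
    qed
  qed
  then have "c ` {..<n} = c ` ({..<n} - repeats c n)"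
    by auto
  then have "card (c ` {..<n}) = card ({..<n} - repeats c n)"
    by (simp add: card_image inj_on_diff_repeats)
  also have "\<dots> = n - card (repeats c n)"
    by (subst card_Diff_subset) (auto simp: repeats_def)
  finally show ?thesis
    using card_mono[of "{..<n}" "repeats c n"] by (force simp: repeats_def)
qed

section \<open>Lower bound on the number of repeats\<close>

text \<open>Properness excludes distance 1, so the repeat falls among the last \<open>d\<close>
  positions of the window. This is why windows only \<open>d\<close> apart still have different
  repeats.\<close>

lemma window_repeat:
  assumes "valid_coloring (d + 2) (with_proj (path_graph n)) c" "s + d + 2 \<le> n"
  obtains i j where "s \<le> i" "i + 2 \<le> j" "j \<le> s + d + 1" "c i = c j" "j \<in> repeats c n"
proof -
  have proper: "\<And>i. Suc i < n \<Longrightarrow> c i \<noteq> c (Suc i)" and "\<not> inj_on c {s..<s + (d + 2)}"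
    using assms by (auto simp: valid_coloring_path_graph_iff)
  then obtain i j where ij: "s \<le> i" "i < j" "j < s + (d + 2)" "c i = c j"
    unfolding inj_on_def by (metis atLeastLessThan_iff linorder_neqE_nat)
  have "j \<noteq> Suc i"
    using proper[of i] ij assms(2) by auto
  then show ?thesis
    using ij assms(2) by (intro that[of i j]) (auto simp: repeats_def)
qed

text \<open>The block containing \<open>j\<close> can be read off from \<open>j\<close>: its index
  is \<open>(j - 2) div d\<close>.\<close>

lemma interval_index_unique:
  fixes d j s t :: nat
  assumes "s * d + 2 \<le> j" "j \<le> s * d + d + 1" "t * d + 2 \<le> j" "j \<le> t * d + d + 1"
  shows "s = t"
proof -
  have "u = (j - 2) div d" if "u * d + 2 \<le> j" "j \<le> u * d + d + 1" for u
    using that by (intro div_nat_eqI[symmetric]) (auto simp: mult.commute)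
  then show ?thesis using assms by metis
qed

text \<open>The window starting at \<open>t * d\<close> supplies \<open>J t\<close>. The map is
  kept, not just the count, because the uniqueness argument needs the positions.\<close>

lemma obtain_repeats:
  assumes "valid_coloring (d + 2) (with_proj (path_graph n)) c" "m * d + 2 \<le> n"
  obtains J where "inj_on J {..<m}" "J ` {..<m} \<subseteq> repeats c n"
    "\<And>t. t < m \<Longrightarrow> t * d + 2 \<le> J t \<and> J t \<le> t * d + d + 1"
proof -
  have "\<exists>j. j \<in> repeats c n \<and> t * d + 2 \<le> j \<and> j \<le> t * d + d + 1" if "t < m" for t
  proof -
    have "Suc t * d \<le> m * d"
      using that by (intro mult_le_mono1) simp
    then have "t * d + d + 2 \<le> n"
      using assms(2) by simp
    from window_repeat[OF assms(1) this] obtain i j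
      where "t * d \<le> i" "i + 2 \<le> j" "j \<le> t * d + d + 1" "j \<in> repeats c n" by blast
    then show ?thesis by (intro exI[of _ j]) auto
  qed
  then obtain J where J: "\<And>t. t < m \<Longrightarrow> J t \<in> repeats c n \<and> t * d + 2 \<le> J t \<and> J t \<le> t * d + d + 1"
    by metis
  have "inj_on J {..<m}"
  proof (rule inj_onI)
    fix s t assume "s \<in> {..<m}" "t \<in> {..<m}" "J s = J t"
    then show "s = t"
      using J[of s] J[of t] by (intro interval_index_unique[of s d "J s" t]) auto
  qed
  then show ?thesis
    using J by (intro that[of J]) auto
qed

lemma card_repeats_ge:
  assumes "valid_coloring (d + 2) (with_proj (path_graph n)) c" "m * d + 2 \<le> n"
  shows "m \<le> card (repeats c n)"
  using obtain_repeats[OF assms] card_inj_on_le[of _ "{..<m}" "repeats c n"]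
  by (metis card_lessThan finite_repeats)

section \<open>Colorings with prescribed repeats\<close>

text \<open>Two is the least distance at which a proper coloring can repeat a color. Taking the
  index as the new color makes it larger than all earlier colors. The guard \<open>2 \<le> j\<close>
  gives termination under truncated subtraction.\<close>

fun chain_coloring :: "nat set \<Rightarrow> nat \<Rightarrow> nat" where
  "chain_coloring S j = (if j \<in> S \<and> 2 \<le> j then chain_coloring S (j - 2) else j)"

declare chain_coloring.simps [simp del]

lemma chain_coloring_notin [simp]: "j \<notin> S \<Longrightarrow> chain_coloring S j = j"
  by (simp add: chain_coloring.simps)

lemma chain_coloring_le: "chain_coloring S j \<le> j"
proof (induction j rule: less_induct)
  case (less j)
  have "chain_coloring S (j - 2) \<le> j" if "2 \<le> j"
    using less[of "j - 2"] that by linarith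
  then show ?case
    by (subst chain_coloring.simps) auto
qed

text \<open>As \<open>S\<close> contains neither 0 nor 1, the guard never stops the recursion inside
  \<open>S\<close>.\<close>

lemma chain_coloring_notin_range:
  assumes "S \<subseteq> {2..}"
  shows "chain_coloring S j \<notin> S"
proof (induction j rule: less_induct)
  case (less j)
  then show ?case
    using assms less[of "j - 2"] by (subst chain_coloring.simps) auto
qed

text \<open>In the induction step, a vertex that copies the color two steps back turns the claim
  into the one for the preceding pair. Otherwise its color is its own index, which exceeds every
  earlier color.\<close>

lemma chain_coloring_Suc_neq:
  "chain_coloring S j \<noteq> chain_coloring S (Suc j)"
proof (induction j)
  case 0
  then show ?case by (simp add: chain_coloring.simps)
next
  case (Suc j)
  show ?case
  proof (cases "Suc (Suc j) \<in> S")
    case True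
    then have "chain_coloring S (Suc (Suc j)) = chain_coloring S j"
      by (subst chain_coloring.simps) simp
    then show ?thesis using Suc.IH by metis
  next
    case False
    then show ?thesis
      using chain_coloring_le[of S "Suc j"] by auto
  qed
qed

lemma card_image_chain_coloring:
  assumes "S \<subseteq> {2..}"
  shows "card (chain_coloring S ` {..<n}) = card ({..<n} - S)"
proof -
  have "chain_coloring S ` {..<n} = {..<n} - S"
  proof
    show "chain_coloring S ` {..<n} \<subseteq> {..<n} - S"
      using chain_coloring_notin_range[OF assms] chain_coloring_le[of S]
      by (auto intro: le_less_trans)
    show "{..<n} - S \<subseteq> chain_coloring S ` {..<n}"
      by (auto intro!: rev_image_eqI)
  qed
  then show ?thesis by simp
qed

text \<open>A vertex of \<open>S\<close> among the last \<open>d\<close> positions of a window has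
  the vertex whose color it copies in the same window.\<close>

lemma valid_chain_coloring:
  assumes "S \<subseteq> {2..}"
    and "\<And>s. s + d + 2 \<le> n \<Longrightarrow> \<exists>j\<in>S. s + 2 \<le> j \<and> j \<le> s + d + 1"
  shows "valid_coloring (d + 2) (with_proj (path_graph n)) (chain_coloring S)"
proof -
  have "\<not> inj_on (chain_coloring S) {s..<s + (d + 2)}" if "s + (d + 2) \<le> n" for s
  proof
    assume inj: "inj_on (chain_coloring S) {s..<s + (d + 2)}"
    obtain j where j: "j \<in> S" "s + 2 \<le> j" "j \<le> s + d + 1"
      using assms(2)[of s] \<open>s + (d + 2) \<le> n\<close> by auto
    then have "chain_coloring S j = chain_coloring S (j - 2)"
      by (subst chain_coloring.simps) auto
    moreover have "j \<in> {s..<s + (d + 2)}" "j - 2 \<in> {s..<s + (d + 2)}"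
      using j by auto
    ultimately have "j = j - 2"
      by (rule inj_onD[OF inj])
    then show False using j(2) by simp
  qed
  then show ?thesis
    by (simp add: valid_coloring_path_graph_iff chain_coloring_Suc_neq)
qed

text \<open>\<open>chain_coloring\<close> maps each vertex to the first occurrence of its color, and
  \<open>c\<close> is injective on first occurrences. Hence the set of repeats alone determines the
  partition.\<close>

lemma chain_coloring_repeats_eq_iff:
  assumes rep: "repeats c n \<subseteq> {2..}" and chain: "\<And>j. j \<in> repeats c n \<Longrightarrow> c j = c (j - 2)"
    and "u < n" "v < n"
  shows "c u = c v \<longleftrightarrow> chain_coloring (repeats c n) u = chain_coloring (repeats c n) v"
proof -
  let ?f = "chain_coloring (repeats c n)"
  have f: "c (?f j) = c j" for j
  proof (induction j rule: less_induct)
    case (less j)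
    show ?case
    proof (cases "j \<in> repeats c n")
      case True
      then have "2 \<le> j" using rep by auto
      then have "?f j = ?f (j - 2)"
        using True by (subst chain_coloring.simps) simp
      then show ?thesis
        using less[of "j - 2"] chain[OF True] \<open>2 \<le> j\<close> by simp
    qed simp
  qed
  have "?f j \<in> {..<n} - repeats c n" if "j < n" for j
    using that chain_coloring_notin_range[OF rep, of j] le_less_trans[OF chain_coloring_le] by simp
  then have "c (?f u) = c (?f v) \<longleftrightarrow> ?f u = ?f v"
    using inj_on_eq_iff[OF inj_on_diff_repeats[of c n]] assms(3,4) by blast
  then show ?thesis
    by (simp only: f)
qed

section \<open>Optimal colorings\<close>

text \<open>The vertex \<open>t * d + 1\<close> is the last one of the window starting at
  \<open>(t - 1) * d\<close>, the latest possible place for its repeat.\<close>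

definition standard_repeats :: "nat \<Rightarrow> nat \<Rightarrow> nat set" where
  "standard_repeats d r = (\<lambda>t. t * d + 1) ` {1..r}"

lemma standard_repeats_subset: "0 < d \<Longrightarrow> standard_repeats d r \<subseteq> {2..r * d + 1}"
  by (auto simp: standard_repeats_def)

lemma card_standard_repeats: "0 < d \<Longrightarrow> card (standard_repeats d r) = r"
  unfolding standard_repeats_def by (subst card_image) (auto simp: inj_on_def)

lemma standard_repeats_window:
  assumes "0 < d" "s < r * d"
  shows "\<exists>j\<in>standard_repeats d r. s + 2 \<le> j \<and> j \<le> s + d + 1"
proof
  \<comment> \<open>\<open>t * d\<close> is the least multiple of \<open>d\<close> above
    \<open>s\<close>, hence at most \<open>s + d\<close>.\<close>
  define t where "t = s div d + 1"
  have "s div d < r"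
    using assms by (simp add: less_mult_imp_div_less)
  then show "t * d + 1 \<in> standard_repeats d r"
    unfolding standard_repeats_def by (intro image_eqI[of _ _ t]) (auto simp: t_def)
  show "s + 2 \<le> t * d + 1 \<and> t * d + 1 \<le> s + d + 1"
    using dividend_less_div_times[OF assms(1), of s] div_times_less_eq_dividend[of s d]
    by (simp add: t_def)
qed

text \<open>Supplies the hypothesis of \<open>standard_repeats_window\<close> for every window that
  fits into the path.\<close>

lemma window_start_less:
  fixes d n s :: nat
  assumes "0 < d" "s + d + 2 \<le> n"
  shows "s < (n - 2) div d * d"
proof -
  have "(s + d) div d \<le> (n - 2) div d"
    using assms(2) by (intro div_le_mono) simp
  then have "s div d < (n - 2) div d"
    using assms(1) by simp
  then show ?thesis
    using assms(1) by (simp add: div_less_iff_less_mult)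
qed

lemma num_colors_chain_coloring:
  assumes "S \<subseteq> {2..<n}"
  shows "num_colors (with_proj (path_graph n)) (chain_coloring S) = n - card S"
proof -
  have "card ({..<n} - S) = n - card S"
    using assms by (subst card_Diff_subset) (auto intro: finite_subset)
  moreover have "S \<subseteq> {2..}"
    using assms by auto
  ultimately show ?thesis
    by (simp add: num_colors_def path_graph_def card_image_chain_coloring)
qed

lemma cp_path_graph:
  assumes "0 < d" "2 \<le> n"
  shows "cp (d + 2) (with_proj (path_graph n)) = n - (n - 2) div d"
proof -
  define r where "r = (n - 2) div d"
  define S where "S = standard_repeats d r"
  have r: "r * d + 2 \<le> n"
    using assms div_times_less_eq_dividend[of "n - 2" d] unfolding r_def by linarith
  have S: "S \<subseteq> {2..<n}"
    using standard_repeats_subset[OF assms(1), of r] r by (auto simp: S_def)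
  have "valid_coloring (d + 2) (with_proj (path_graph n)) (chain_coloring S)"
  proof (rule valid_chain_coloring)
    fix s assume "s + d + 2 \<le> n"
    then show "\<exists>j\<in>S. s + 2 \<le> j \<and> j \<le> s + d + 1"
      unfolding S_def r_def
      by (intro standard_repeats_window[OF assms(1)] window_start_less[OF assms(1)])
  qed (use S in auto)
  moreover have "num_colors (with_proj (path_graph n)) (chain_coloring S) = n - r"
    using num_colors_chain_coloring[OF S] card_standard_repeats[OF assms(1)] by (simp add: S_def)
  ultimately have "n - r \<in> {num_colors (with_proj (path_graph n)) c |c.
      valid_coloring (d + 2) (with_proj (path_graph n)) c}"
    by (auto intro!: exI[of _ "chain_coloring S"])
  moreover have "num_colors (with_proj (path_graph n)) c \<le> n - r"
    if "valid_coloring (d + 2) (with_proj (path_graph n)) c" for c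
    using card_repeats_ge[OF that r] card_image_add_repeats[of c n]
    by (simp add: num_colors_def path_graph_def)
  moreover have "finite {num_colors (with_proj (path_graph n)) c |c.
      valid_coloring (d + 2) (with_proj (path_graph n)) c}"
  proof -
    interpret pair_graph "path_graph n" by (rule pair_graph_path_graph)
    show ?thesis using finite_num_colors .
  qed
  ultimately show ?thesis
    unfolding cp_def r_def[symmetric] by (intro Max_eqI) auto
qed

lemma optimal_coloring_path_graph_iff:
  assumes "0 < d" "2 \<le> n"
  shows "optimal_coloring (d + 2) (with_proj (path_graph n)) c \<longleftrightarrow>
    valid_coloring (d + 2) (with_proj (path_graph n)) c \<and> card (repeats c n) = (n - 2) div d"
proof -
  \<comment> \<open>Keeps the truncated subtraction exact, so that it can be cancelled.\<close>
  have "(n - 2) div d \<le> n"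
    using div_le_dividend[of "n - 2" d] by linarith
  moreover have "x = n - z \<longleftrightarrow> y = z" if "x + y = n" "z \<le> n" for x y z
    using that by auto
  ultimately have "card (c ` {..<n}) = n - (n - 2) div d \<longleftrightarrow> card (repeats c n) = (n - 2) div d"
    using card_image_add_repeats[of c n] by blast
  then show ?thesis
    unfolding optimal_coloring_def cp_path_graph[OF assms] num_colors_def
    by (simp add: path_graph_def)
qed

lemma optimal_chain_coloring:
  assumes "0 < d" "2 \<le> n" "S \<subseteq> {2..<n}" "card S = (n - 2) div d"
    and "\<And>s. s + d + 2 \<le> n \<Longrightarrow> \<exists>j\<in>S. s + 2 \<le> j \<and> j \<le> s + d + 1"
  shows "optimal_coloring (d + 2) (with_proj (path_graph n)) (chain_coloring S)"
proof -
  have "S \<subseteq> {2..}" using assms(3) by auto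
  from valid_chain_coloring[OF this assms(5)] show ?thesis
    by (simp only: optimal_coloring_def cp_path_graph[OF assms(1,2)]
        num_colors_chain_coloring[OF assms(3)] assms(4) simp_thms)
qed

lemma optimal_standard_coloring:
  assumes "0 < d" "2 \<le> n"
  shows "optimal_coloring (d + 2) (with_proj (path_graph n))
    (chain_coloring (standard_repeats d ((n - 2) div d)))"
  using assms
proof (rule optimal_chain_coloring)
  have "(n - 2) div d * d + 2 \<le> n"
    using assms div_times_less_eq_dividend[of "n - 2" d] by linarith
  then show "standard_repeats d ((n - 2) div d) \<subseteq> {2..<n}"
    using standard_repeats_subset[OF assms(1), of "(n - 2) div d"] by auto
next
  fix s assume "s + d + 2 \<le> n"
  then show "\<exists>j\<in>standard_repeats d ((n - 2) div d). s + 2 \<le> j \<and> j \<le> s + d + 1"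
    by (intro standard_repeats_window[OF assms(1)] window_start_less[OF assms(1)])
qed (rule card_standard_repeats[OF assms(1)])

section \<open>Uniqueness and non-uniqueness of optimal colorings\<close>

text \<open>Each block from \<open>t * d + 2\<close> to \<open>t * d + d + 1\<close> contains
  exactly one repeat. Once the repeat of block \<open>t + 1\<close> is known to lie just beyond the
  window starting at \<open>t * d + d - 1\<close>, that window must take its repeat from the last
  position of block \<open>t\<close>.\<close>

lemma optimal_repeats_forced:
  assumes "0 < d" "n = m * d + 1" "0 < m"
    and opt: "optimal_coloring (d + 2) (with_proj (path_graph n)) c"
  shows "repeats c n = standard_repeats d (m - 1)"
    and "\<And>j. j \<in> repeats c n \<Longrightarrow> c j = c (j - 2)"
proof -
  define r where "r = m - 1"
  have n: "n = r * d + d + 1"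
    using assms(2,3) by (cases m) (auto simp: r_def)
  have "(n - 2) div d = r"
    using assms(1) by (intro div_nat_eqI) (auto simp: n mult.commute)
  moreover have "2 \<le> n"
    using assms(1) n by simp
  ultimately have valid: "valid_coloring (d + 2) (with_proj (path_graph n)) c"
    and card: "card (repeats c n) = r"
    using opt by (simp_all only: optimal_coloring_path_graph_iff[OF assms(1)])
  have "r * d + 2 \<le> n"
    using assms(1) n by simp
  from obtain_repeats[OF valid this] obtain J where J: "inj_on J {..<r}" "J ` {..<r} \<subseteq> repeats c n"
    "\<And>t. t < r \<Longrightarrow> t * d + 2 \<le> J t \<and> J t \<le> t * d + d + 1" by blast
  have R: "repeats c n = J ` {..<r}"
    using J(1,2) card by (intro card_subset_eq[symmetric]) (auto simp: card_image)
  have last: "J t = t * d + d + 1 \<and> c (J t) = c (J t - 2)" if "t < r" for t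
    using that
  proof (induction "r - t" arbitrary: t rule: less_induct)
    case less
    \<comment> \<open>Position \<open>s + 2\<close> is the end of block \<open>t\<close>. For
      \<open>t = r - 1\<close> the window ends exactly at the last vertex of the path, and there is
      no later block.\<close>
    define s where "s = t * d + d - 1"
    have s: "Suc s = t * d + d"
      using assms(1) by (simp add: s_def)
    have "Suc t * d \<le> r * d"
      using less.prems by (intro mult_le_mono1) simp
    then have "s + d + 2 \<le> n"
      using s n by simp
    from window_repeat[OF valid this] obtain i j where ij:
      "s \<le> i" "i + 2 \<le> j" "j \<le> s + d + 1" "c i = c j" "j \<in> repeats c n" by blast
    obtain t' where t': "t' < r" "j = J t'"
      using ij(5) R by auto
    have "t' \<le> t"
    proof (rule ccontr)
      assume "\<not> t' \<le> t"
      then have "Suc t * d \<le> t' * d"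
        by (intro mult_le_mono1) simp
      \<comment> \<open>For \<open>t' = Suc t\<close> the forced repeat is \<open>s + d + 2\<close>,
        one past the window; for larger \<open>t'\<close> it lies farther out.\<close>
      moreover have "t' = Suc t \<or> Suc (Suc t) * d \<le> t' * d"
        using \<open>\<not> t' \<le> t\<close> by (cases "t' = Suc t") (auto intro!: mult_le_mono1 simp del: mult_Suc)
      moreover have "J t' = t' * d + d + 1"
        using less.hyps[of t'] t' \<open>\<not> t' \<le> t\<close> by auto
      ultimately show False
        using ij(3) t'(2) s by auto
    qed
    then have "t' * d \<le> t * d"
      by (rule mult_le_mono1)
    moreover have "J t' \<le> t' * d + d + 1"
      using J(3)[OF t'(1)] by simp
    \<comment> \<open>The bound \<open>s + 2 \<le> j\<close> and the upper end of block
      \<open>t'\<close> leave a single value.\<close>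
    ultimately have j: "j = t * d + d + 1" and "t' * d = t * d"
      using ij(1,2) s t'(2) by linarith+
    then have "t' = t"
      using assms(1) by simp
    moreover have "i = j - 2"
      using ij(1,2) s j by linarith
    ultimately show ?case
      using j t' ij(4) by simp
  qed
  have "J ` {..<r} = (\<lambda>t. t * d + 1) ` Suc ` {..<r}"
    unfolding image_image using last by (intro image_cong) auto
  also have "Suc ` {..<r} = {1..r}"
    by (simp add: lessThan_atLeast0 image_Suc_atLeastLessThan atLeastLessThanSuc_atLeastAtMost)
  finally show "repeats c n = standard_repeats d (m - 1)"
    by (simp add: R standard_repeats_def r_def)
  show "c j = c (j - 2)" if "j \<in> repeats c n" for j
    using that last unfolding R by (metis imageE lessThan_iff)
qed

lemma unique_optimal_coloring_path_graph:
  assumes "0 < d" "n = m * d + 1" "0 < m"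
  shows "unique_optimal_coloring (d + 2) (with_proj (path_graph n))"
proof -
  let ?G = "with_proj (path_graph n)"
  let ?f = "chain_coloring (standard_repeats d (m - 1))"
  have "0 < m * d"
    using assms(1,3) by simp
  then have "2 \<le> n"
    using assms(2) by linarith
  have classes: "color_classes ?G c = color_classes ?G ?f" if "optimal_coloring (d + 2) ?G c" for c
  proof -
    note forced = optimal_repeats_forced[OF assms that]
    have "repeats c n \<subseteq> {2..}"
      using standard_repeats_subset[OF assms(1), of "m - 1"] forced(1) by auto
    from chain_coloring_repeats_eq_iff[OF this forced(2)] show ?thesis
      unfolding color_classes_eq_iff forced(1)[symmetric] by (auto simp: path_graph_def)
  qed
  \<comment> \<open>Only existence is left. The standard coloring serves as witness without
    identifying \<open>(n - 2) div d\<close> with \<open>m - 1\<close>, since \<open>classes\<close>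
    applies to every optimal coloring.\<close>
  then show ?thesis
    unfolding unique_optimal_coloring_def
    using optimal_standard_coloring[OF assms(1) \<open>2 \<le> n\<close>] by metis
qed

text \<open>\<open>T\<close> is the standard set of repeats, and \<open>S\<close> has its last
  element \<open>m * d + 1\<close> moved to \<open>m * d\<close>. The vertices \<open>m * d\<close>
  and \<open>m * d - 2\<close> tell the two partitions apart.\<close>

lemma not_unique_optimal_coloring_path_graph:
  assumes "n = m * d + q + 1" "0 < q" "q < d" "0 < m"
  shows "\<not> unique_optimal_coloring (d + 2) (with_proj (path_graph n))"
proof
  let ?G = "with_proj (path_graph n)"
  have d: "0 < d" "2 \<le> d"
    using assms by auto
  have md: "d \<le> m * d"
    using assms(4) by simp
  have n: "2 \<le> n"
    using assms by simp
  \<comment> \<open>Here \<open>n - 2 = m * d + (q - 1)\<close>, so \<open>0 < q\<close> is what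
    raises the number of repeats to \<open>m\<close>.\<close>
  have m: "(n - 2) div d = m"
    using assms by (intro div_nat_eqI) (auto simp: mult.commute)
  define S where "S = insert (m * d) (standard_repeats d (m - 1))"
  define T where "T = standard_repeats d m"
  have m1: "(m - 1) * d + d = m * d"
    using assms(4) by (cases m) auto
  have sub: "standard_repeats d (m - 1) \<subseteq> {2..(m - 1) * d + 1}"
    using standard_repeats_subset[OF d(1)] .
  then have notin: "m * d \<notin> standard_repeats d (m - 1)"
    using m1 d by auto
  have S: "S \<subseteq> {2..<n}"
    using sub assms(1) m1 d md unfolding S_def by auto
  have "card S = m"
    using notin card_standard_repeats[OF d(1), of "m - 1"] assms(4) finite_subset[OF sub]
    by (simp add: S_def)
  moreover have "\<exists>j\<in>S. s + 2 \<le> j \<and> j \<le> s + d + 1" if "s + d + 2 \<le> n" for s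
  proof (cases "s < (m - 1) * d")
    case True
    then show ?thesis
      using standard_repeats_window[OF d(1)] unfolding S_def by blast
  next
    \<comment> \<open>Because \<open>q < d\<close>, every window starts at \<open>m * d - 2\<close>
      or earlier, so the moved repeat still serves the late windows.\<close>
    case False
    then show ?thesis
      using that assms m1 unfolding S_def by (intro bexI[of _ "m * d"]) auto
  qed
  ultimately have opt_S: "optimal_coloring (d + 2) ?G (chain_coloring S)"
    using optimal_chain_coloring[OF d(1) n S] m by simp
  have opt_T: "optimal_coloring (d + 2) ?G (chain_coloring T)"
    using optimal_standard_coloring[OF d(1) n] m by (simp add: T_def)
  have eq: "chain_coloring S (m * d) = chain_coloring S (m * d - 2)"
    using le_trans[OF d(2) md] by (subst chain_coloring.simps) (simp add: S_def)
  \<comment> \<open>All elements of \<open>T\<close> are 1 modulo \<open>d\<close>, and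
    \<open>d\<close> is at least 2.\<close>
  have "m * d \<notin> T"
  proof
    assume "m * d \<in> T"
    then obtain t where "m * d = t * d + 1"
      by (auto simp: T_def standard_repeats_def)
    then have "d dvd t * d + 1"
      by (metis dvd_triv_right)
    then have "d dvd 1"
      by (simp only: dvd_add_times_triv_left_iff)
    then show False
      using d by simp
  qed
  moreover have "chain_coloring T (m * d - 2) < m * d"
    using chain_coloring_le[of T "m * d - 2"] d md by linarith
  ultimately have "chain_coloring T (m * d) \<noteq> chain_coloring T (m * d - 2)"
    by simp
  then have "color_classes ?G (chain_coloring S) \<noteq> color_classes ?G (chain_coloring T)"
    using eq assms(1) unfolding color_classes_eq_iff by (force simp: path_graph_def)
  moreover assume "unique_optimal_coloring (d + 2) ?G"
  ultimately show False
    using opt_S opt_T unfolding unique_optimal_coloring_def by metis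
qed

section \<open>The closed formula and the theorem\<close>

text \<open>With \<open>n = r * d + q + 2\<close> the numerator equals
  \<open>(n - r) * d - (q + 1)\<close>, where \<open>q + 1\<close> lies between 1 and
  \<open>d\<close>; so the quotient is at least \<open>n - r - 1\<close> and less than
  \<open>n - r\<close>.\<close>

lemma floor_cp_formula:
  assumes "0 < d" "2 \<le> n"
  shows "\<lfloor>((real d - 1) * real n + 1) / real d\<rfloor> + 1 = int (n - (n - 2) div d)"
proof -
  define r q where "r = (n - 2) div d" and "q = (n - 2) mod d"
  have "n - 2 = r * d + q"
    by (simp add: r_def q_def)
  then have n: "n = r * d + q + 2"
    using assms(2) by linarith
  have "q < d" using assms(1) by (simp add: q_def)
  have "r \<le> n"
    unfolding r_def using div_le_dividend[of "n - 2" d] by linarith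
  have "\<lfloor>((real d - 1) * real n + 1) / real d\<rfloor> = int n - int r - 1"
  proof (rule floor_unique)
    have rn: "real n = real r * real d + real q + 2" "real q + 1 \<le> real d"
      using n \<open>q < d\<close> by simp_all
    have "(real n - real r - 1) * real d \<le> (real d - 1) * real n + 1"
      "(real d - 1) * real n + 1 < (real n - real r) * real d"
    proof -
      have "(real d - 1) * real n + 1 = (real n - real r) * real d - (real q + 1)"
        by (simp add: rn(1) algebra_simps)
      then show "(real n - real r - 1) * real d \<le> (real d - 1) * real n + 1"
        "(real d - 1) * real n + 1 < (real n - real r) * real d"
        using rn(2) by (simp_all add: left_diff_distrib)
    qed
    then show "real_of_int (int n - int r - 1) \<le> ((real d - 1) * real n + 1) / real d"
      and "((real d - 1) * real n + 1) / real d < real_of_int (int n - int r - 1) + 1"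
      using assms(1) by (simp_all add: pos_le_divide_eq pos_divide_less_eq)
  qed
  then show ?thesis
    using \<open>r \<le> n\<close> by (simp add: r_def)
qed

theorem theorem2:
  fixes k :: nat
  assumes "k \<ge> 3"
  shows "(\<forall>n\<ge>2. int (cp k (with_proj (path_graph n))) =
            \<lfloor>((real k - 3) * real n + 1) / (real k - 2)\<rfloor> + 1) \<and>
         (\<forall>n\<ge>k - 1. unique_optimal_coloring k (with_proj (path_graph n)) \<longleftrightarrow>
            (\<exists>m::nat. n = m * (k - 2) + 1))"
proof (intro conjI allI impI)
  define d where "d = k - 2"
  have d: "0 < d" and k: "k = d + 2"
    using assms by (simp_all add: d_def)
  have rk: "real k - 3 = real d - 1" "real k - 2 = real d"
    using k by simp_all
  fix n :: nat
  show "int (cp k (with_proj (path_graph n))) =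
      \<lfloor>((real k - 3) * real n + 1) / (real k - 2)\<rfloor> + 1" if "2 \<le> n"
    unfolding rk floor_cp_formula[OF d that] using cp_path_graph[OF d that] k by simp
  assume "k - 1 \<le> n"
  then have n: "d + 1 \<le> n" using k by simp
  \<comment> \<open>Dividing \<open>n - 1\<close> instead of \<open>n - 2\<close> makes
    \<open>q = 0\<close> the residue condition of the statement, and \<open>k - 1 \<le> n\<close>
    gives \<open>0 < m\<close>.\<close>
  define m q where "m = (n - 1) div d" and "q = (n - 1) mod d"
  have "n - 1 = m * d + q"
    by (simp add: m_def q_def)
  then have nq: "n = m * d + q + 1"
    using n by linarith
  have "0 < m"
    using n d by (simp add: m_def div_greater_zero_iff)
  have "q < d"
    using d by (simp add: q_def)
  show "unique_optimal_coloring k (with_proj (path_graph n)) \<longleftrightarrow> (\<exists>m. n = m * (k - 2) + 1)"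
  proof (cases "q = 0")
    case True
    then show ?thesis
      using unique_optimal_coloring_path_graph[OF d, of n m] nq \<open>0 < m\<close> k by auto
  next
    case False
    have "q = 0" if "n = m' * d + 1" for m'
      using that by (simp add: q_def)
    then show ?thesis
      using not_unique_optimal_coloring_path_graph[OF nq _ \<open>q < d\<close> \<open>0 < m\<close>] False k by auto
  qed
qed

end
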